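(* Let $x\geq 2$ and $c\geq 1$ be integers, let $\ell=2\lfloor\frac{x-1}{2}\rfloor$, let $a,b_2,b_4,\ldots,b_\ell\geq 0$ be integers, and let $$L=\{1^{a},2^{b_2},4^{b_4},6^{b_6},\ldots,\ell^{b_\ell},x^c\}$$ be an admissible list, where $v=|L|+1$. Then there exists a Hamiltonian path $H$ of $K_v$ with $\ell(H)=L$ in each of the following cases: (1) $x$ is even and $a\geq x-1$; (2) $x$ is odd and $a\geq 3x-4$.
   Context: $K_v$ is the complete graph on vertex set $\{0,1,\ldots,v-1\}$. The length of an edge $[x,y]$ is $\min(|x-y|,\,v-|x-y|)$, and for a subgraph $H$, $\ell(H)$ is the list (multiset) of lengths of its edges. The notation $\{1^{a_1},2^{a_2},\ldots,t^{a_t}\}$ denotes the multiset containing $a_i$ copies of $i$; $|L|$ is its total size. A list $L$ of $v-1$ positive integers not exceeding $\lfloor v/2\rfloor$ is called admissible if for every divisor $d$ of $v$, the number of elements of $L$ (with multiplicity) that are multiples of $d$ is at most $v-d$. *)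

theory Defs
  imports "HOL-Library.Multiset"
begin

(* A simple graph is given by a vertex set and a set of two-element sets of vertices. *)

definition complete_graph :: "nat \<Rightarrow> nat set set" where
  "complete_graph v = {{x, y} | x y. x < v \<and> y < v \<and> x \<noteq> y}"

(* For e = {x, y} the difference Max e - Min e is |x - y|. *)
definition edge_length :: "nat \<Rightarrow> nat set \<Rightarrow> nat" where
  "edge_length v e = min (Max e - Min e) (v - (Max e - Min e))"

definition edge_lengths :: "nat \<Rightarrow> nat set set \<Rightarrow> nat multiset" where
  "edge_lengths v H = image_mset (edge_length v) (mset_set H)"

definition path_edges :: "'a list \<Rightarrow> 'a set set" where
  "path_edges p = {{p ! i, p ! Suc i} | i. Suc i < length p}"

(* H is the edge set of the path; since the path is spanning, its vertex set is V. *)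
definition hamiltonian_path :: "'a set \<Rightarrow> 'a set set \<Rightarrow> 'a set set \<Rightarrow> bool" where
  "hamiltonian_path V E H \<longleftrightarrow>
     H \<subseteq> E \<and> (\<exists>p. distinct p \<and> set p = V \<and> H = path_edges p)"

definition admissible :: "nat \<Rightarrow> nat multiset \<Rightarrow> bool" where
  "admissible v L \<longleftrightarrow>
     size L + 1 = v \<and>
     (\<forall>k\<in>#L. 1 \<le> k \<and> k \<le> v div 2) \<and>
     (\<forall>d. d dvd v \<longrightarrow> size (filter_mset (\<lambda>k. d dvd k) L) \<le> v - d)"

end

theory Submission
  imports Defs
begin

text \<open>
  Since \<open>L\<close> has no element above \<open>v/2\<close>, it suffices to realize \<open>L\<close> linearly, by a path on
  \<open>{0..<v}\<close> whose absolute differences form \<open>L\<close>.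

  For even \<open>x = 2k\<close> the vertices are added in increasing order. The part built so far consists of
  paths (chords) whose \<open>2j\<close> endpoints are the topmost \<open>2j\<close> vertices, each chord ending in two
  adjacent ones. Prolonging both ends of the lowest chord by \<open>2j\<close> consumes two copies of \<open>2j\<close>
  and preserves this shape; starting a new chord consumes a \<open>1\<close> and replaces \<open>j\<close> by \<open>j + 1\<close>.
  This uses up the even part of every multiplicity. The \<open>k\<close> final chords are connected by
  \<open>k - 1\<close> edges, one of length \<open>2j\<close> for each odd multiplicity with \<open>j < k\<close>, the others of
  length \<open>1\<close>; a last edge of length \<open>x\<close> if \<open>c\<close> is odd and all remaining ones form a tail that
  ends in the top vertex.

  For odd \<open>x\<close> this path, built for \<open>x - 1\<close>, is continued above its top vertex by a path through the
  residue classes modulo \<open>x\<close> that realizes \<open>2x - 2\<close> ones and \<open>c\<close> copies of \<open>x\<close>.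
\<close>

declare mset_upt [simp del]

section \<open>Difference multisets and linear realizations\<close>

lemma replicate_mset_plus:
  "replicate_mset (m + n) x = replicate_mset m x + replicate_mset n x"
  by (induction m) auto

text \<open>Subtraction is truncated, so one of the two summands is zero and their sum is the
  absolute difference.\<close>

fun steps :: "nat list \<Rightarrow> nat multiset" where
  "steps (x # y # zs) = add_mset ((x - y) + (y - x)) (steps (y # zs))"
| "steps _ = {#}"

lemma steps_Cons:
  "ys \<noteq> [] \<Longrightarrow> steps (x # ys) = add_mset ((x - hd ys) + (hd ys - x)) (steps ys)"
  by (cases ys) auto

lemma steps_append:
  assumes "xs \<noteq> []" "ys \<noteq> []"
  shows "steps (xs @ ys) =
    add_mset ((last xs - hd ys) + (hd ys - last xs)) (steps xs + steps ys)"
  using assms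
proof (induction xs)
  case (Cons x xs)
  then show ?case by (cases "xs = []") (auto simp: steps_Cons)
qed simp

lemma steps_rev: "steps (rev xs) = steps xs"
proof (induction xs)
  case (Cons x xs)
  then show ?case
    by (cases "xs = []") (auto simp: steps_append steps_Cons last_rev add.commute)
qed simp

lemma steps_map_add: "steps (map (\<lambda>i. i + s) xs) = steps xs"
  by (induction xs rule: steps.induct) auto

lemma steps_upt: "steps [m..<m + n] = replicate_mset (n - 1) 1"
proof (induction n)
  case (Suc n)
  then show ?case by (cases "n = 0") (auto simp: steps_append simp flip: replicate_mset_Suc)
qed simp

definition realizes :: "nat list \<Rightarrow> nat \<Rightarrow> nat multiset \<Rightarrow> bool" where
  "realizes p v L \<longleftrightarrow> mset p = mset [0..<v] \<and> steps p = L"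

lemma realizes_nonempty: "realizes p v L \<Longrightarrow> 0 < v \<Longrightarrow> p \<noteq> []"
  using mset_eq_length[of p "[0..<v]"] by (auto simp: realizes_def)

text \<open>A path has one vertex more than edges; this recovers the order of the final path from
  \<open>L\<close>.\<close>

lemma realizes_size: "realizes p v L \<Longrightarrow> 0 < v \<Longrightarrow> v = size L + 1"
proof -
  have sz: "p \<noteq> [] \<Longrightarrow> size (steps p) + 1 = length p" for p
    by (induction p rule: steps.induct) auto
  assume "realizes p v L" "0 < v"
  then show ?thesis
    using sz[of p] realizes_nonempty[of p v L] mset_eq_length[of p "[0..<v]"]
    by (auto simp: realizes_def)
qed

section \<open>From linear realizations to Hamiltonian paths\<close>

lemma path_edges_Cons_Cons: "path_edges (x # y # zs) = insert {x, y} (path_edges (y # zs))"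
proof (intro equalityI subsetI)
  fix e assume "e \<in> path_edges (x # y # zs)"
  then obtain i where "e = {(x # y # zs) ! i, (x # y # zs) ! Suc i}" "Suc i < length (x # y # zs)"
    unfolding path_edges_def by blast
  then show "e \<in> insert {x, y} (path_edges (y # zs))"
    unfolding path_edges_def by (cases i) auto
next
  fix e assume "e \<in> insert {x, y} (path_edges (y # zs))"
  then consider "e = {x, y}"
    | i where "e = {(y # zs) ! i, (y # zs) ! Suc i}" "Suc i < length (y # zs)"
    unfolding path_edges_def by blast
  then show "e \<in> path_edges (x # y # zs)"
  proof cases
    case 1
    then show ?thesis unfolding path_edges_def by (intro CollectI exI[of _ 0]) auto
  next
    case 2
    then show ?thesis unfolding path_edges_def by (intro CollectI exI[of _ "Suc i"]) auto
  qed
qed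

lemma path_edges_subset: "e \<in> path_edges p \<Longrightarrow> e \<subseteq> set p"
  unfolding path_edges_def by auto

text \<open>Differences up to \<open>v div 2\<close> are cyclic lengths, and distinctness makes each
  edge new, so no multiplicity is lost.\<close>

lemma edge_lengths_path_edges:
  assumes "distinct p" "\<forall>k \<in># steps p. k \<le> v div 2"
  shows "finite (path_edges p) \<and> edge_lengths v (path_edges p) = steps p"
  using assms
proof (induction p rule: steps.induct)
  case (1 x y zs)
  have new: "{x, y} \<notin> path_edges (y # zs)"
    using path_edges_subset[of "{x, y}" "y # zs"] 1(2) by auto
  have "edge_length v {x, y} = (x - y) + (y - x)"
  proof (cases "x \<le> y")
    case True
    then show ?thesis using 1(3) by (auto simp: edge_length_def max_def min_def)
  next
    case False
    then show ?thesis using 1(3) by (auto simp: edge_length_def max_def min_def)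
  qed
  then show ?case using 1 new by (auto simp: path_edges_Cons_Cons edge_lengths_def)
qed (auto simp: path_edges_def edge_lengths_def)

lemma hamiltonian_path_of_realizes:
  assumes "realizes p v L" "\<forall>k \<in># L. k \<le> v div 2"
  shows "\<exists>H. hamiltonian_path {0..<v} (complete_graph v) H \<and> edge_lengths v H = L"
proof -
  have m: "mset p = mset [0..<v]" and s: "steps p = L"
    using assms(1) by (auto simp: realizes_def)
  have d: "distinct p" using mset_eq_imp_distinct_iff[OF m] by simp
  have st: "set p = {0..<v}" using mset_eq_setD[OF m] by simp
  have "path_edges p \<subseteq> complete_graph v"
  proof
    fix e assume "e \<in> path_edges p"
    then obtain i where i: "e = {p ! i, p ! Suc i}" "Suc i < length p"
      unfolding path_edges_def by blast
    then have "p ! i \<in> set p" "p ! Suc i \<in> set p" by auto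
    moreover have "p ! i \<noteq> p ! Suc i" using d i by (simp add: nth_eq_iff_index_eq)
    ultimately show "e \<in> complete_graph v"
      using i(1) st unfolding complete_graph_def by auto
  qed
  then show ?thesis
    using d st edge_lengths_path_edges[OF d, of v] assms(2) s
    unfolding hamiltonian_path_def by blast
qed


subsection \<open>Chord systems\<close>

primrec chords :: "nat \<Rightarrow> nat list list \<Rightarrow> bool" where
  "chords s [] \<longleftrightarrow> True"
| "chords s (P # Ps) \<longleftrightarrow> P \<noteq> [] \<and> hd P = s \<and> last P = s + 1 \<and> chords (s + 2) Ps"

lemma chords_snoc:
  "chords s (Ps @ [P]) \<longleftrightarrow> chords s Ps \<and> P \<noteq> [] \<and>
    hd P = s + 2 * length Ps \<and> last P = s + 2 * length Ps + 1"
  by (induction Ps arbitrary: s) auto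

text \<open>The vertices below \<open>s\<close> are interior to the paths; the \<open>2 * k\<close>
  vertices from \<open>s\<close> on are exactly their ends.\<close>

definition chord_system :: "nat \<Rightarrow> nat \<Rightarrow> nat list list \<Rightarrow> nat multiset \<Rightarrow> bool" where
  "chord_system k s Ps M \<longleftrightarrow> length Ps = k \<and> chords s Ps \<and>
     mset (concat Ps) = mset [0..<s + 2 * k] \<and> (\<Sum>P\<leftarrow>Ps. steps P) = M"

lemma chord_system_add_chord:
  assumes "chord_system k s Ps M"
  shows "chord_system (Suc k) s (Ps @ [[s + 2 * k, s + 2 * k + 1]]) (M + {#1#})"
  using assms by (auto simp: chord_system_def chords_snoc)

text \<open>The ends \<open>s\<close> and \<open>s + 1\<close> of the lowest chord are prolonged to
  \<open>s + 2 * k\<close> and \<open>s + 2 * k + 1\<close>, and it becomes the topmost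
  chord.\<close>

lemma chord_system_rotate:
  assumes "chord_system k s Ps M" "0 < k"
  shows "\<exists>Qs. chord_system k (s + 2) Qs (M + {#2 * k, 2 * k#})"
proof -
  obtain P Rs where Ps: "Ps = P # Rs"
    using assms by (cases Ps) (auto simp: chord_system_def)
  let ?P = "(s + 2 * k) # P @ [s + 2 * k + 1]"
  have "P \<noteq> []" "hd P = s" "last P = s + 1" and k: "k = Suc (length Rs)"
    using assms(1) Ps by (auto simp: chord_system_def)
  then have "steps ?P = steps P + {#2 * k, 2 * k#}"
    by (simp add: steps_Cons steps_append)
  then have "chord_system k (s + 2) (Rs @ [?P]) (M + {#2 * k, 2 * k#})"
    using assms(1) Ps k by (auto simp: chord_system_def chords_snoc ac_simps)
  then show ?thesis by blast
qed

lemma chord_system_rotate_many: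
  assumes "chord_system k s Ps M" "0 < k"
  shows "\<exists>Qs. chord_system k (s + 2 * e) Qs (M + replicate_mset (2 * e) (2 * k))"
proof (induction e)
  case (Suc e)
  then obtain Qs where "chord_system k (s + 2 * e) Qs (M + replicate_mset (2 * e) (2 * k))"
    by blast
  from chord_system_rotate[OF this assms(2)] show ?case by simp
qed (use assms in auto)

text \<open>Length \<open>2 * j\<close> is absorbed while there are exactly \<open>j\<close> chords,
  hence in increasing order of \<open>j\<close>: one new chord, then \<open>e j\<close>
  rotations.\<close>

lemma chord_system_exists:
  "\<exists>s Ps. chord_system k s Ps
     (replicate_mset k 1 + (\<Sum>j\<in>{1..k}. replicate_mset (2 * e j) (2 * j)))"
proof (induction k)
  case 0
  have "chord_system 0 0 [] {#}" by (simp add: chord_system_def)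
  then show ?case by auto
next
  case (Suc k)
  then obtain s Ps where "chord_system k s Ps
     (replicate_mset k 1 + (\<Sum>j\<in>{1..k}. replicate_mset (2 * e j) (2 * j)))" by blast
  from chord_system_rotate_many[OF chord_system_add_chord[OF this], of "e (Suc k)"]
  show ?case by (auto simp: algebra_simps)
qed

text \<open>
  The joins zigzag between the two ends of the shrinking window of chords that are still
  unvisited: with \<open>j\<close> of them left, the path has just left the window at one side, and it
  continues either at the near side (length 1) or at the far side (length \<open>2 j\<close>). Either
  choice leaves a window of \<open>j - 1\<close> chords in the same position.
\<close>
lemma zigzag:
  fixes t :: "nat \<Rightarrow> bool"
  assumes "chords s Ps" "Ps \<noteq> []"
  defines "M \<equiv> (\<Sum>P\<leftarrow>Ps. steps P) +
    (\<Sum>j\<in>{1..<length Ps}. {#if t j then 2 * j else 1#})"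
  shows "(\<exists>q. q \<noteq> [] \<and> hd q = s \<and> mset q = mset (concat Ps) \<and> steps q = M) \<and>
    (\<exists>q. q \<noteq> [] \<and> hd q = s + 2 * length Ps - 1 \<and> mset q = mset (concat Ps) \<and> steps q = M)"
  using assms(1,2) unfolding M_def
proof (induction "length Ps" arbitrary: Ps s)
  case 0
  then show ?case by simp
next
  case (Suc k)
  show ?case
  proof (cases "k = 0")
    case True
    then obtain P where P: "Ps = [P]"
      using Suc.hyps(2) by (cases Ps) auto
    show ?thesis
      using Suc.prems P by (intro conjI exI[of _ P] exI[of _ "rev P"]) (auto simp: hd_rev steps_rev)
  next
    case False
    let ?J = "{#if t k then 2 * k else 1#}"
    have J: "(\<Sum>j\<in>{1..<length Ps}. {#if t j then 2 * j else 1#}) =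
      (\<Sum>j\<in>{1..<k}. {#if t j then 2 * j else 1#}) + ?J"
      using False by (simp add: Suc.hyps(2)[symmetric])
    obtain P Rs where P: "Ps = P # Rs" using Suc.hyps(2) by (cases Ps) auto
    have cR: "chords (s + 2) Rs" "length Rs = k" "Rs \<noteq> []"
      and Pe: "P \<noteq> []" "hd P = s" "last P = s + 1"
      using Suc.prems Suc.hyps(2) P False by auto
    note IH1 = Suc.hyps(1)[OF cR(2)[symmetric] cR(1) cR(3)]
    \<comment> \<open>\<open>P\<close> is left at \<open>s + 1\<close>: entering the rest at
      \<open>s + 2\<close> costs 1, at \<open>s + 2 * k + 1\<close> it costs \<open>2 * k\<close>.
      The two halves of the induction hypothesis supply these two heads.\<close>
    obtain q where q: "q \<noteq> []" "mset q = mset (concat Rs)"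
      "steps q = (\<Sum>P\<leftarrow>Rs. steps P) + (\<Sum>j\<in>{1..<k}. {#if t j then 2 * j else 1#})"
      "hd q = (if t k then s + 2 * k + 1 else s + 2)"
      using IH1 cR(2) False by (cases "t k") auto
    have up: "steps (P @ q) = (\<Sum>P\<leftarrow>Ps. steps P) +
        (\<Sum>j\<in>{1..<length Ps}. {#if t j then 2 * j else 1#})"
      unfolding J using P Pe q by (auto simp: steps_append)
    obtain P' Rs' where P': "Ps = Rs' @ [P']"
      using Suc.prems by (cases Ps rule: rev_cases) auto
    have cR': "chords s Rs'" "length Rs' = k" "Rs' \<noteq> []"
      and Pe': "P' \<noteq> []" "hd P' = s + 2 * k" "last P' = s + 2 * k + 1"
      using Suc.prems Suc.hyps(2) P' False by (auto simp: chords_snoc)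
    note IH2 = Suc.hyps(1)[OF cR'(2)[symmetric] cR'(1) cR'(3)]
    obtain q' where q': "q' \<noteq> []" "mset q' = mset (concat Rs')"
      "steps q' = (\<Sum>P\<leftarrow>Rs'. steps P) + (\<Sum>j\<in>{1..<k}. {#if t j then 2 * j else 1#})"
      "hd q' = (if t k then s else s + 2 * k - 1)"
      using IH2 cR'(2) False by (cases "t k") auto
    have down: "steps (rev P' @ q') = (\<Sum>P\<leftarrow>Ps. steps P) +
        (\<Sum>j\<in>{1..<length Ps}. {#if t j then 2 * j else 1#})"
      unfolding J using P' Pe' q' False by (auto simp: steps_append last_rev steps_rev)
    have u: "mset (P @ q) = mset (concat Ps)" "hd (P @ q) = s" "P @ q \<noteq> []"
      using P Pe q(2) by auto
    have d: "mset (rev P' @ q') = mset (concat Ps)" "rev P' @ q' \<noteq> []"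
      "hd (rev P' @ q') = s + 2 * length Ps - 1"
      using P' Pe' q'(2) Suc.hyps(2) by (auto simp: hd_rev)
    show ?thesis
      by (rule conjI[OF exI[of _ "P @ q"] exI[of _ "rev P' @ q'"]]) (intro conjI u d up down)+
  qed
qed

section \<open>Linear realization with even lengths\<close>

lemma realizes_extend_top:
  assumes "realizes p v L" "hd p = v - 1" "0 < v"
  shows "\<exists>q. realizes q (v + n) (L + replicate_mset n 1) \<and> hd q = v + n - 1"
proof (induction n)
  case (Suc n)
  then obtain q where q: "realizes q (v + n) (L + replicate_mset n 1)" "hd q = v + n - 1"
    by blast
  then have "realizes ((v + n) # q) (v + Suc n) (L + replicate_mset (Suc n) 1)"
    using assms(3) realizes_nonempty[OF q(1)] by (auto simp: realizes_def steps_Cons)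
  then show ?case by (intro exI[of _ "(v + n) # q"]) auto
qed (use assms in auto)

text \<open>The chords use \<open>k\<close> ones and their \<open>k - 1\<close> joins at most
  \<open>k - 1\<close> more, whence the bound on \<open>a\<close>; surplus ones extend the path at
  its top.\<close>

lemma even_realization:
  assumes "0 < k" "2 * k - 1 \<le> a"
  shows "\<exists>p v. 0 < v \<and> hd p = v - 1 \<and>
    realizes p v (replicate_mset a 1 + (\<Sum>j\<in>{1..k}. replicate_mset (f j) (2 * j)))"
proof -
  let ?E = "\<Sum>j\<in>{1..k}. replicate_mset (2 * (f j div 2)) (2 * j)"
  let ?Z = "\<Sum>j\<in>{1..<k}. {#if odd (f j) then 2 * j else 1#}"
  obtain s Ps where cs: "chord_system k s Ps (replicate_mset k 1 + ?E)"
    using chord_system_exists[of k "\<lambda>j. f j div 2"] by blast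
  let ?n = "s + 2 * k"
  have "chords s Ps" "Ps \<noteq> []" "length Ps = k" "mset (concat Ps) = mset [0..<?n]"
    "(\<Sum>P\<leftarrow>Ps. steps P) = replicate_mset k 1 + ?E"
    using cs assms(1) by (auto simp: chord_system_def)
  with zigzag[of s Ps "\<lambda>j. odd (f j)"] obtain q q' where
    q: "realizes q ?n (replicate_mset k 1 + ?E + ?Z)" "hd q = s" and
    q': "realizes q' ?n (replicate_mset k 1 + ?E + ?Z)" "hd q' = ?n - 1"
    unfolding realizes_def by auto
  define T where "T = replicate_mset (f k mod 2) (2 * k)"
  obtain p w where p: "0 < w" "hd p = w - 1"
    "realizes p w (replicate_mset k 1 + ?E + ?Z + T)"
  \<comment> \<open>The joins absorb odd copies for \<open>j < k\<close>. One left over for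
    \<open>2 * k\<close> joins a new top vertex \<open>?n\<close> to the head \<open>s\<close>;
    otherwise the traversal headed by \<open>?n - 1\<close> is taken.\<close>
  proof (cases "odd (f k)")
    case True
    have "realizes (?n # q) (?n + 1) (replicate_mset k 1 + ?E + ?Z + T)"
      using q assms(1) True realizes_nonempty[OF q(1)]
      by (auto simp: realizes_def steps_Cons T_def odd_iff_mod_2_eq_one)
    then show ?thesis using that[of "?n + 1" "?n # q"] by simp
  next
    case False
    then have "T = {#}" by (simp add: T_def even_iff_mod_2_eq_zero)
    then show ?thesis using that[of ?n q'] q' assms(1) by simp
  qed
  \<comment> \<open>\<open>m\<close> counts the joins of length 1, one for each even
    \<open>f j\<close>.\<close>
  have Z: "\<exists>m \<le> n - 1. (\<Sum>j\<in>{1..<n}. {#if odd (f j) then 2 * j else 1#}) =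
    replicate_mset m 1 + (\<Sum>j\<in>{1..<n}. replicate_mset (f j mod 2) (2 * j))" for n
  proof (induction n)
    case (Suc n)
    then obtain m where m: "m \<le> n - 1" "(\<Sum>j\<in>{1..<n}. {#if odd (f j) then 2 * j else 1#}) =
      replicate_mset m 1 + (\<Sum>j\<in>{1..<n}. replicate_mset (f j mod 2) (2 * j))" by blast
    show ?case
    proof (cases "n = 0")
      case False
      then show ?thesis using m
        by (intro exI[of _ "if odd (f n) then m else Suc m"])
          (auto simp: odd_iff_mod_2_eq_one even_iff_mod_2_eq_zero)
    qed simp
  qed simp
  obtain m where m: "m \<le> k - 1"
    "?Z = replicate_mset m 1 + (\<Sum>j\<in>{1..<k}. replicate_mset (f j mod 2) (2 * j))"
    using Z by blast
  have rest: "?E + ((\<Sum>j\<in>{1..<k}. replicate_mset (f j mod 2) (2 * j)) + T) =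
    (\<Sum>j\<in>{1..k}. replicate_mset (f j) (2 * j))"
  proof -
    have "(\<Sum>j\<in>{1..<k}. replicate_mset (f j mod 2) (2 * j)) + T =
      (\<Sum>j\<in>{1..k}. replicate_mset (f j mod 2) (2 * j))"
      using assms(1) by (cases k) (auto simp: T_def atLeastLessThanSuc_atLeastAtMost)
    moreover have "replicate_mset (2 * (f j div 2)) (2 * j) + replicate_mset (f j mod 2) (2 * j) =
      replicate_mset (f j) (2 * j)" for j
      by (simp flip: replicate_mset_plus)
    ultimately show ?thesis by (simp flip: sum.distrib)
  qed
  have "replicate_mset k 1 + ?E + ?Z + T + replicate_mset (a - (k + m)) 1 =
    replicate_mset (k + m + (a - (k + m))) 1 + (?E + ((\<Sum>j\<in>{1..<k}. replicate_mset (f j mod 2) (2 * j)) + T))"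
    unfolding m(2) replicate_mset_plus by (simp only: ac_simps)
  moreover have "k + m + (a - (k + m)) = a" using m(1) assms by simp
  ultimately have eq: "replicate_mset k 1 + ?E + ?Z + T + replicate_mset (a - (k + m)) 1 =
    replicate_mset a 1 + (\<Sum>j\<in>{1..k}. replicate_mset (f j) (2 * j))"
    unfolding rest by (simp only:)
  have "0 < w + (a - (k + m))" using p(1) by simp
  then show ?thesis
    using realizes_extend_top[OF p(3,2,1), of "a - (k + m)"] unfolding eq by blast
qed


subsection \<open>Blocks for an odd length\<close>

text \<open>For \<open>j < x\<close> this is the residue class of \<open>j\<close> modulo
  \<open>x\<close> inside \<open>{0..<x * Suc q}\<close>.\<close>

definition column :: "nat \<Rightarrow> nat \<Rightarrow> nat \<Rightarrow> nat list" where
  "column x q j = map (\<lambda>i. j + i * x) [0..<Suc q]"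

text \<open>Neighbouring columns are run in opposite directions, so passing between them costs a
  step of length 1.\<close>

fun snake :: "nat \<Rightarrow> nat \<Rightarrow> nat \<Rightarrow> nat list" where
  "snake x q 0 = []"
| "snake x q (Suc m) = snake x q m @ (if even m then column x q m else rev (column x q m))"

lemma column_simps:
  "column x q j \<noteq> []" "hd (column x q j) = j" "last (column x q j) = j + q * x"
  "steps (column x q j) = replicate_mset q x"
proof -
  show "column x q j \<noteq> []" "hd (column x q j) = j" "last (column x q j) = j + q * x"
    by (simp_all add: column_def hd_map del: upt_Suc) simp_all
  show "steps (column x q j) = replicate_mset q x"
  proof (induction q)
    case (Suc q)
    have "column x (Suc q) j = column x q j @ [j + Suc q * x]" by (simp add: column_def)
    moreover have "last (column x q j) = j + q * x" "column x q j \<noteq> []" 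
      by (simp_all add: column_def)
    ultimately show ?case using Suc by (simp add: steps_append)
  qed (simp add: column_def)
qed

lemma snake_ends:
  assumes "0 < m"
  shows "snake x q m \<noteq> []" "hd (snake x q m) = 0"
    "last (snake x q m) = (if odd m then m - 1 + q * x else m - 1)"
proof -
  have "snake x q m \<noteq> [] \<and> hd (snake x q m) = 0 \<and>
    last (snake x q m) = (if odd m then m - 1 + q * x else m - 1)"
    using assms
  proof (induction m)
    case (Suc m)
    then show ?case by (cases "m = 0") (auto simp: column_simps last_rev)
  qed simp
  then show "snake x q m \<noteq> []" "hd (snake x q m) = 0"
    "last (snake x q m) = (if odd m then m - 1 + q * x else m - 1)" by auto
qed

lemma steps_snake: "steps (snake x q m) = replicate_mset (m - 1) 1 + replicate_mset (m * q) x"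
proof (induction m)
  case (Suc m)
  show ?case
  proof (cases "m = 0")
    case False
    then have "steps (snake x q (Suc m)) =
      add_mset 1 (steps (snake x q m) + replicate_mset q x)"
      using snake_ends[of m x q]
      by (auto simp: steps_append column_simps steps_rev hd_rev)
    then show ?thesis using False Suc by (cases m) (auto simp: replicate_mset_plus ac_simps)
  qed (simp add: column_simps)
qed simp

text \<open>Counting by rows, row \<open>i\<close> contributes \<open>m\<close> consecutive vertices
  from \<open>i * x\<close> on; for \<open>m = x\<close> the rows abut.\<close>

lemma mset_snake_full: "mset (snake x q x) = mset [0..<x * Suc q]"
proof -
  have cnt: "mset (snake x q m) = (\<Sum>i\<in>{0..<Suc q}. mset [i * x..<i * x + m])" for m
  proof (induction m)
    case (Suc m)
    have "mset (column x q m) = (\<Sum>i\<in>{0..<Suc q}. {#i * x + m#})" 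
      by (induction q) (auto simp: column_def ac_simps)
    then show ?case using Suc by (simp add: sum.distrib[symmetric] del: sum.op_ivl_Suc)
  qed simp
  have "(\<Sum>i\<in>{0..<n}. mset [i * x..<i * x + x]) = mset [0..<n * x]" for n
  proof (induction n)
    case (Suc n)
    have "[0..<Suc n * x] = [0..<n * x] @ [n * x..<n * x + x]"
      using upt_add_eq_append[of 0 "n * x" x] by (simp add: add.commute)
    then show ?case using Suc by simp
  qed simp
  from this[of "Suc q"] show ?thesis using cnt[of x] by (simp only: mult.commute)
qed

lemma mset_snake_1: "mset (snake x 1 m) = mset [0..<m] + mset [x..<x + m]"
  by (induction m) (auto simp: column_def)

text \<open>With an odd number of columns the last one is run upwards, so the path ends at the top
  vertex, ready for gluing.\<close>

lemma realizes_snake: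
  assumes "odd x"
  shows "realizes (snake x q x) (x * Suc q) (replicate_mset (x - 1) 1 + replicate_mset (x * q) x)"
    "last (snake x q x) = x * Suc q - 1"
  using assms mset_snake_full[of x q] steps_snake[of x q x] snake_ends(3)[of x x q] odd_pos[OF assms]
  by (simp_all add: realizes_def mult.commute)

text \<open>In \<open>{0..<x + r}\<close> the classes of the residues below \<open>r\<close> have
  two elements, the others one. The parity of \<open>r\<close> decides at which level a snake
  through the former ends.\<close>

lemma short_realization:
  assumes "r < x"
  shows "\<exists>p. realizes p (x + r) (replicate_mset (x - 1) 1 + replicate_mset r x) \<and> hd p = 0"
proof (cases "even r")
  case True
  show ?thesis
  proof (cases "r = 0")
    case True
    then show ?thesis using steps_upt[of 0 x] assms
      by (intro exI[of _ "[0..<x]"]) (auto simp: realizes_def)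
  next
    case False
    \<comment> \<open>An even number of columns brings the snake back down to \<open>r - 1\<close>,
      next to the run from \<open>r\<close> to \<open>x - 1\<close>.\<close>
    let ?p = "snake x 1 r @ [r..<x]"
    note e = snake_ends[of r x 1]
    have "steps [r..<x] = replicate_mset (x - r - 1) 1"
      using steps_upt[of r "x - r"] assms by simp
    then have "steps ?p = replicate_mset (Suc (r - 1 + (x - r - 1))) 1 + replicate_mset r x"
      unfolding replicate_mset_Suc replicate_mset_plus
      using False True e assms by (simp add: steps_append steps_snake)
    moreover have "Suc (r - 1 + (x - r - 1)) = x - 1" using False assms by simp
    ultimately have "steps ?p = replicate_mset (x - 1) 1 + replicate_mset r x" by metis
    moreover have "[0..<r] @ [r..<x] @ [x..<x + r] = [0..<x + r]"
      using upt_add_eq_append[of 0 r "x - r"] upt_add_eq_append[of 0 x r] assms by simp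
    then have "mset ?p = mset [0..<x + r]"
      unfolding mset_append mset_snake_1 by (metis mset_append union_assoc union_commute)
    ultimately show ?thesis using e False by (intro exI[of _ ?p]) (auto simp: realizes_def)
  qed
next
  case False
  \<comment> \<open>The path jumps from \<open>0\<close> to \<open>x\<close> and descends to
    \<open>r\<close>. The columns \<open>1\<close> to \<open>r - 1\<close>, even in number, are then
    entered at \<open>r - 1\<close> by a shifted and reversed snake; for \<open>r = 1\<close> there
    are none.\<close>
  let ?q = "rev [r..<Suc x]"
  have q: "steps ?q = replicate_mset (x - r) 1" "hd ?q = x" "last ?q = r" "?q \<noteq> []"
    using steps_upt[of r "Suc x - r"] assms
    by (simp_all add: steps_rev last_rev hd_rev del: upt_Suc)
  show ?thesis
  proof (cases "r = 1")
    case True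
    have "[0..<x + 1] = 0 # [1..<Suc x]" by (simp add: upt_conv_Cons del: upt_Suc)
    then show ?thesis using q True assms
      by (intro exI[of _ "0 # ?q"]) (simp add: realizes_def steps_Cons del: upt_Suc)
  next
    case r1: False
    let ?s = "snake x 1 (r - 1)"
    let ?t = "rev (map (\<lambda>i. i + 1) ?s)"
    have r: "r \<ge> 3" using False r1 by (cases r) (auto elim: oddE)
    note e = snake_ends[of "r - 1" x 1]
    have t: "?t \<noteq> []" "hd ?t = r - 1" "steps ?t = replicate_mset (r - 2) 1 + replicate_mset (r - 1) x"
      using e r False
      by (auto simp: hd_rev last_map steps_rev steps_map_add steps_snake simp del: One_nat_def)
    have "steps (0 # ?q @ ?t) = replicate_mset (Suc (x - r + (r - 2))) 1 + replicate_mset (Suc (r - 1)) x"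
      unfolding replicate_mset_Suc replicate_mset_plus
      using q t r by (simp add: steps_Cons steps_append del: upt_Suc)
    moreover have "Suc (x - r + (r - 2)) = x - 1" "Suc (r - 1) = r" using r assms by auto
    moreover have "mset (0 # ?q @ ?t) = mset [0..<x + r]"
    proof -
      have "mset ?t = mset [1..<r] + mset [Suc x..<x + r]"
      proof -
        have "mset ?t = image_mset Suc (mset ?s)" by simp
        also have "\<dots> = mset (map Suc [0..<r - 1]) + mset (map Suc [x..<x + (r - 1)])"
          unfolding mset_snake_1 by simp
        finally show ?thesis using r unfolding map_Suc_upt by simp
      qed
      moreover have "[0..<x + r] = 0 # [1..<r] @ [r..<Suc x] @ [Suc x..<x + r]"
      proof -
        have split: "[i..<n] = [i..<m] @ [m..<n]" if "i \<le> m" "m \<le> n" for i m n :: nat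
          using upt_add_eq_append[of i m "n - m"] that by simp
        have "[0..<x + r] = 0 # [1..<x + r]" using r by (subst upt_conv_Cons) auto
        also have "[1..<x + r] = [1..<r] @ [r..<x + r]" using r by (intro split) auto
        also have "[r..<x + r] = [r..<Suc x] @ [Suc x..<x + r]" using r assms by (intro split) auto
        finally show ?thesis .
      qed
      ultimately show ?thesis by (simp del: upt_Suc)
    qed
    ultimately show ?thesis
      unfolding realizes_def by (intro exI[of _ "0 # ?q @ ?t"]) (metis list.sel(1))
  qed
qed

section \<open>Gluing paths and the final case split\<close>

lemma realizes_rev: "realizes p v L \<Longrightarrow> realizes (rev p) v L"
  by (simp add: realizes_def steps_rev)

text \<open>The shift by \<open>v - 1\<close> identifies the head \<open>0\<close> of
  \<open>q\<close> with the last vertex of \<open>p\<close>; the shared vertex is kept once and no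
  extra edge arises.\<close>

lemma realizes_glue:
  assumes p: "realizes p v L" "last p = v - 1" "0 < v"
    and q: "realizes q w M" "hd q = 0" "0 < w"
  shows "\<exists>r. realizes r (v + w - 1) (L + M) \<and> hd r = hd p"
proof -
  obtain q' where q': "q = 0 # q'" using q realizes_nonempty[OF q(1)] by (cases q) auto
  let ?t = "map (\<lambda>i. i + (v - 1)) q'"
  have pn: "p \<noteq> []" using p realizes_nonempty by blast
  have "steps (p @ ?t) = steps p + steps q"
  proof (cases "q' = []")
    case False
    then show ?thesis using pn p(2) q'
      by (simp add: steps_append steps_map_add steps_Cons hd_map)
  qed (simp add: q')
  moreover have "mset (p @ ?t) = mset [0..<v + w - 1]"
  proof -
    have "[0..<w] = 0 # [1..<w]" using q(3) by (simp add: upt_conv_Cons)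
    then have "mset q' = mset [1..<w]" using q(1) q' by (simp add: realizes_def)
    then have "mset ?t = mset (map (\<lambda>i. i + (v - 1)) [1..<w])" by simp
    also have "map (\<lambda>i. i + (v - 1)) [1..<w] = [v..<v + w - 1]"
      using p(3) q(3) by (intro nth_equalityI) auto
    finally show ?thesis
      using p(1,3) q(3) upt_add_eq_append[of 0 v "w - 1"] by (simp add: realizes_def)
  qed
  ultimately show ?thesis using p(1) q(1) pn q' p(2)
    by (intro exI[of _ "p @ ?t"]) (auto simp: realizes_def)
qed

text \<open>With \<open>c = x * (c div x) + c mod x\<close>, a full snake takes the multiple of
  \<open>x\<close> and a short path the remainder; each uses \<open>x - 1\<close> ones.\<close>

lemma odd_realization:
  assumes "odd x"
  shows "\<exists>p v. 0 < v \<and> hd p = 0 \<and> realizes p v (replicate_mset (2 * x - 2) 1 + replicate_mset c x)"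
proof -
  have x: "0 < x" using assms by (rule odd_pos)
  obtain s where s: "realizes s (x + c mod x) (replicate_mset (x - 1) 1 + replicate_mset (c mod x) x)"
    "hd s = 0"
    using short_realization[of "c mod x" x] x by auto
  obtain p where p: "realizes p (x * Suc (c div x) + (x + c mod x) - 1)
     (replicate_mset (x - 1) 1 + replicate_mset (x * (c div x)) x +
      (replicate_mset (x - 1) 1 + replicate_mset (c mod x) x))" "hd p = 0"
    using realizes_glue[OF realizes_snake[OF assms, of "c div x"] _ s] snake_ends(2)[OF x] x
    by (metis add_gr_0 nat_0_less_mult_iff zero_less_Suc)
  have "replicate_mset (x - 1) 1 + replicate_mset (x * (c div x)) x +
      (replicate_mset (x - 1) 1 + replicate_mset (c mod x) x) =
    replicate_mset ((x - 1) + (x - 1)) 1 + replicate_mset (x * (c div x) + c mod x) x"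
    unfolding replicate_mset_plus by (simp only: ac_simps)
  also have "\<dots> = replicate_mset (2 * x - 2) 1 + replicate_mset c x"
  proof -
    have "(x - 1) + (x - 1) = 2 * x - 2" by simp
    then show ?thesis by (simp only: mult_div_mod_eq)
  qed
  finally have "realizes p (x * Suc (c div x) + (x + c mod x) - 1)
    (replicate_mset (2 * x - 2) 1 + replicate_mset c x)"
    using p(1) by (simp only:)
  moreover have "0 < x * Suc (c div x) + (x + c mod x) - 1" using x by simp
  ultimately show ?thesis using p(2) by blast
qed

theorem theorem1p7:
  fixes x c l a v :: nat and b :: "nat \<Rightarrow> nat" and L :: "nat multiset"
  assumes "x \<ge> 2" and "c \<ge> 1"
    and "l = 2 * ((x - 1) div 2)"
    and "L = replicate_mset a 1
           + (\<Sum>i\<in>{i. even i \<and> 2 \<le> i \<and> i \<le> l}. replicate_mset (b i) i)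
           + replicate_mset c x"
    and "v = size L + 1"
    and "admissible v L"
    and "(even x \<and> a \<ge> x - 1) \<or> (odd x \<and> a \<ge> 3 * x - 4)"
  shows "\<exists>H. hamiltonian_path {0..<v} (complete_graph v) H \<and> edge_lengths v H = L"
proof -
  define h where "h = (x - 1) div 2"
  have "{i. even i \<and> 2 \<le> i \<and> i \<le> l} = (\<lambda>j. 2 * j) ` {1..h}"
    unfolding assms(3) h_def[symmetric] by (auto elim!: evenE)
  then have "(\<Sum>i\<in>{i. even i \<and> 2 \<le> i \<and> i \<le> l}. replicate_mset (b i) i) =
    (\<Sum>j\<in>{1..h}. replicate_mset (b (2 * j)) (2 * j))"
    by (simp add: sum.reindex inj_on_def)
  then have L: "L = replicate_mset a 1 + (\<Sum>j\<in>{1..h}. replicate_mset (b (2 * j)) (2 * j))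
    + replicate_mset c x"
    using assms(4) by simp
  have "\<exists>p w. 0 < w \<and> realizes p w L"
  proof (cases "even x")
    case True
    \<comment> \<open>Here \<open>x = 2 * Suc h\<close> is the even number after
      \<open>l = 2 * h\<close>, so \<open>c\<close> serves as one more even multiplicity.\<close>
    define f where "f j = (if j = Suc h then c else b (2 * j))" for j
    have x: "x = 2 * Suc h" using True assms(1) unfolding h_def by (auto elim!: evenE)
    have "(\<Sum>j\<in>{1..Suc h}. replicate_mset (f j) (2 * j)) =
      (\<Sum>j\<in>{1..h}. replicate_mset (b (2 * j)) (2 * j)) + replicate_mset c x"
      by (simp add: f_def x)
    moreover have "2 * Suc h - 1 \<le> a" using assms(7) True x by simp
    ultimately show ?thesis
      using even_realization[of "Suc h" a f] unfolding L by (auto simp: ac_simps)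
  next
    case False
    then have x: "x = 2 * h + 1" "0 < h"
      using assms(1) unfolding h_def by (auto elim!: oddE)
    have a: "3 * x - 4 \<le> a" using assms(7) False by simp
    \<comment> \<open>The bounds fit exactly:
      \<open>(3 * x - 4) - (2 * x - 2) = x - 2 = 2 * h - 1\<close>.\<close>
    then have a': "2 * h - 1 \<le> a - (2 * x - 2)" using x by linarith
    obtain p w where p: "0 < w" "hd p = w - 1" "realizes p w
      (replicate_mset (a - (2 * x - 2)) 1 + (\<Sum>j\<in>{1..h}. replicate_mset (b (2 * j)) (2 * j)))"
      using even_realization[OF x(2) a', of "\<lambda>j. b (2 * j)"] by blast
    obtain q u where q: "0 < u" "hd q = 0"
      "realizes q u (replicate_mset (2 * x - 2) 1 + replicate_mset c x)"
      using odd_realization[OF False] by blast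
    have "last (rev p) = w - 1" using p realizes_nonempty[OF p(3)] by (simp add: last_rev)
    from realizes_glue[OF realizes_rev[OF p(3)] this p(1) q(3,2,1)]
    obtain r where "realizes r (w + u - 1)
      (replicate_mset (a - (2 * x - 2)) 1 + (\<Sum>j\<in>{1..h}. replicate_mset (b (2 * j)) (2 * j)) +
       (replicate_mset (2 * x - 2) 1 + replicate_mset c x))" by blast
    moreover have "a = (a - (2 * x - 2)) + (2 * x - 2)" using a x by simp
    then have "replicate_mset a (1::nat) =
      replicate_mset (a - (2 * x - 2)) 1 + replicate_mset (2 * x - 2) 1"
      by (metis replicate_mset_plus)
    ultimately have "realizes r (w + u - 1) L" unfolding L by (simp add: ac_simps)
    then show ?thesis using p(1) q(1) by (intro exI[of _ r] exI[of _ "w + u - 1"]) auto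
  qed
  then obtain p where "realizes p v L"
    using realizes_size assms(5) by blast
  then show ?thesis
    using hamiltonian_path_of_realizes assms(6) unfolding admissible_def by blast
qed

end
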